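(* Let $\mathcal S=\{g^\eta_\lambda,(X_\lambda,f_\lambda)\}_{\lambda\in\Lambda}$ be an inverse system of multivalued systems indexed by a directed set $(\Lambda,\le)$ (in the sense of the context; in particular $(g^\eta_\lambda,X_\lambda)$ satisfies the Mittag-Leffler condition). Then the pair $\left(\varprojlim\{g^\eta_\lambda,X_\lambda\},\varprojlim f_\lambda\right)$ is an upper semicontinuous multivalued system; that is, $\varprojlim f_\lambda$ takes non-empty closed values in $\varprojlim\{g^\eta_\lambda,X_\lambda\}$ and is upper semicontinuous.
   Context: For a compact Hausdorff space $X$, $2^X$ is the set of non-empty closed subsets of $X$. A map $f:X\to 2^X$ is upper semicontinuous if for every $x\in X$ and every open $U\supset f(x)$ there is an open neighborhood $V$ of $x$ with $f(y)\subset U$ for all $y\in V$. A multivalued map is an upper semicontinuous map $f:X\to2^X$, and $(X,f)$ is then called a multivalued system. For $A\subset X$, $f(A)=\bigcup_{a\in A}f(a)$. An inverse system of multivalued systems $\{g^\eta_\lambda,(X_\lambda,f_\lambda)\}$ over a directed set $(\Lambda,\le)$ consists of multivalued systems $(X_\lambda,f_\lambda)$ ($X_\lambda$ compact Hausdorff) and continuous maps $g^\eta_\lambda:X_\eta\to X_\lambda$ for $\lambda\le\eta$ such that: (i) $g^\eta_\lambda(f_\eta(x))\subset f_\lambda(g^\eta_\lambda(x))$ for all $x\in X_\eta$; (ii) $(g^\eta_\lambda,X_\lambda)$ satisfies the Mittag-Leffler condition: for every $\lambda$ there is $\gamma\ge\lambda$ with $g^\gamma_\lambda(X_\gamma)=g^\eta_\lambda(X_\eta)$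 for all $\eta\ge\gamma$; (iii) $g^\lambda_\lambda=\mathrm{id}$ and $g^\nu_\lambda=g^\eta_\lambda\circ g^\nu_\eta$ for $\lambda\le\eta\le\nu$. $\varprojlim\{g^\eta_\lambda,X_\lambda\}=\{(x_\lambda)\in\prod_\lambda X_\lambda: x_\lambda=g^\eta_\lambda(x_\eta)\text{ for all }\lambda\le\eta\}$ with the topology inherited from the product, and $\varprojlim f_\lambda((x_\lambda))=\{(y_\lambda)\in\varprojlim\{g^\eta_\lambda,X_\lambda\}: y_\lambda\in f_\lambda(x_\lambda)\text{ for all }\lambda\in\Lambda\}$. *)

theory Defs
  imports "HOL-Analysis.Analysis"
begin

(* The hyperspace of non-empty closed subsets, usually written 2^X. *)
definition closed_hyperspace :: "'a topology \<Rightarrow> 'a set set" where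
  "closed_hyperspace X = {C. closedin X C \<and> C \<noteq> {}}"

definition upper_semicontinuous_map :: "'a topology \<Rightarrow> ('a \<Rightarrow> 'a set) \<Rightarrow> bool" where
  "upper_semicontinuous_map X f \<longleftrightarrow>
     (\<forall>x\<in>topspace X. \<forall>U. openin X U \<and> f x \<subseteq> U \<longrightarrow>
        (\<exists>V. openin X V \<and> x \<in> V \<and> (\<forall>y\<in>V. f y \<subseteq> U)))"

definition multivalued_map :: "'a topology \<Rightarrow> ('a \<Rightarrow> 'a set) \<Rightarrow> bool" where
  "multivalued_map X f \<longleftrightarrow>
     f \<in> topspace X \<rightarrow> closed_hyperspace X \<and> upper_semicontinuous_map X f"

definition multivalued_system :: "'a topology \<Rightarrow> ('a \<Rightarrow> 'a set) \<Rightarrow> bool" where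
  "multivalued_system X f \<longleftrightarrow>
     compact_space X \<and> Hausdorff_space X \<and> multivalued_map X f"

(* Here (l, m) \<in> r means l \<le> m; antisymmetry is not required. *)
definition directed_set :: "'i set \<Rightarrow> 'i rel \<Rightarrow> bool" where
  "directed_set \<Lambda> r \<longleftrightarrow>
     \<Lambda> \<noteq> {} \<and> preorder_on \<Lambda> r \<and>
     (\<forall>l\<in>\<Lambda>. \<forall>m\<in>\<Lambda>. \<exists>n\<in>\<Lambda>. (l, n) \<in> r \<and> (m, n) \<in> r)"

(* g l m is the bonding map from X m to X l, defined for (l, m) \<in> r. *)
definition mittag_leffler ::
    "'i set \<Rightarrow> 'i rel \<Rightarrow> ('i \<Rightarrow> 'a topology) \<Rightarrow> ('i \<Rightarrow> 'i \<Rightarrow> 'a \<Rightarrow> 'a) \<Rightarrow> bool" where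
  "mittag_leffler \<Lambda> r X g \<longleftrightarrow>
     (\<forall>l\<in>\<Lambda>. \<exists>c\<in>\<Lambda>. (l, c) \<in> r \<and>
        (\<forall>m\<in>\<Lambda>. (c, m) \<in> r \<longrightarrow> g l c ` topspace (X c) = g l m ` topspace (X m)))"

locale inverse_system_of_multivalued_systems =
  fixes \<Lambda> :: "'i set"
    and r :: "'i rel"
    and X :: "'i \<Rightarrow> 'a topology"
    and f :: "'i \<Rightarrow> 'a \<Rightarrow> 'a set"
    and g :: "'i \<Rightarrow> 'i \<Rightarrow> 'a \<Rightarrow> 'a"
  assumes directed: "directed_set \<Lambda> r"
    and system: "\<And>l. l \<in> \<Lambda> \<Longrightarrow> multivalued_system (X l) (f l)"
    and continuous: "\<And>l m. (l, m) \<in> r \<Longrightarrow> continuous_map (X m) (X l) (g l m)"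
    and bonding_subset:
      "\<And>l m x. (l, m) \<in> r \<Longrightarrow> x \<in> topspace (X m) \<Longrightarrow> g l m ` f m x \<subseteq> f l (g l m x)"
    and mittag_leffler: "mittag_leffler \<Lambda> r X g"
    and bonding_id: "\<And>l x. l \<in> \<Lambda> \<Longrightarrow> x \<in> topspace (X l) \<Longrightarrow> g l l x = x"
    and bonding_comp:
      "\<And>l m n x. (l, m) \<in> r \<Longrightarrow> (m, n) \<in> r \<Longrightarrow> x \<in> topspace (X n) \<Longrightarrow>
         g l n x = g l m (g m n x)"

definition inverse_limit_set ::
    "'i set \<Rightarrow> 'i rel \<Rightarrow> ('i \<Rightarrow> 'a topology) \<Rightarrow> ('i \<Rightarrow> 'i \<Rightarrow> 'a \<Rightarrow> 'a) \<Rightarrow> ('i \<Rightarrow> 'a) set" where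
  "inverse_limit_set \<Lambda> r X g =
     {x \<in> (\<Pi>\<^sub>E l\<in>\<Lambda>. topspace (X l)). \<forall>(l, m)\<in>r. x l = g l m (x m)}"

definition inverse_limit ::
    "'i set \<Rightarrow> 'i rel \<Rightarrow> ('i \<Rightarrow> 'a topology) \<Rightarrow> ('i \<Rightarrow> 'i \<Rightarrow> 'a \<Rightarrow> 'a) \<Rightarrow> ('i \<Rightarrow> 'a) topology" where
  "inverse_limit \<Lambda> r X g = subtopology (product_topology X \<Lambda>) (inverse_limit_set \<Lambda> r X g)"

definition inverse_limit_map ::
    "'i set \<Rightarrow> 'i rel \<Rightarrow> ('i \<Rightarrow> 'a topology) \<Rightarrow> ('i \<Rightarrow> 'i \<Rightarrow> 'a \<Rightarrow> 'a) \<Rightarrow> ('i \<Rightarrow> 'a \<Rightarrow> 'a set)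
      \<Rightarrow> ('i \<Rightarrow> 'a) \<Rightarrow> ('i \<Rightarrow> 'a) set" where
  "inverse_limit_map \<Lambda> r X g f x = {y \<in> inverse_limit_set \<Lambda> r X g. \<forall>l\<in>\<Lambda>. y l \<in> f l (x l)}"

end

theory Submission
  imports Defs
begin

text \<open>
  On a compact Hausdorff space, a map into the hyperspace is upper semicontinuous iff its graph is
  closed: regularity gives one direction, closedness of the projection along a compact factor the
  other. The graph of the limit map is the intersection of the preimages of the graphs of the
  \<open>f l\<close>, hence closed. Its value at \<open>x\<close> is the limit of the inverse system of non-empty compact
  spaces \<open>f l (x l)\<close>, hence non-empty.
\<close>

section \<open>Closed graphs and upper semicontinuity\<close>

lemma multivalued_map_imp_closedin_graph:
  assumes "regular_space X" and "multivalued_map X f"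
  shows "closedin (prod_topology X X) {(x, y). x \<in> topspace X \<and> y \<in> f x}" (is "closedin _ ?G")
proof -
  have closed: "closedin X (f x)" if "x \<in> topspace X" for x
    using assms(2) that by (auto simp: multivalued_map_def closed_hyperspace_def)
  have usc: "\<exists>V. openin X V \<and> x \<in> V \<and> (\<forall>y\<in>V. f y \<subseteq> U)"
    if "x \<in> topspace X" "openin X U" "f x \<subseteq> U" for x U
    using assms(2) that by (auto simp: multivalued_map_def upper_semicontinuous_map_def)
  have "openin (prod_topology X X) (topspace X \<times> topspace X - ?G)"
    unfolding openin_prod_topology_alt
  proof (intro allI impI)
    fix x y
    assume "(x, y) \<in> topspace X \<times> topspace X - ?G"
    then have x: "x \<in> topspace X" and y: "y \<in> topspace X - f x"
      by auto
    \<comment> \<open>\<open>U\<close> and \<open>W\<close> separate \<open>y\<close> from the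
      closed set \<open>f x\<close>. By upper semicontinuity the values stay inside \<open>W\<close>
      near \<open>x\<close>, hence off \<open>U\<close>, so a product neighbourhood of
      \<open>(x, y)\<close> misses the graph.\<close>
    obtain U W where UW: "openin X U" "openin X W" "y \<in> U" "f x \<subseteq> W" "disjnt U W"
      using assms(1)[unfolded regular_space_def, rule_format, of "f x" y] closed[OF x] y
      by blast
    obtain V where V: "openin X V" "x \<in> V" "\<forall>z\<in>V. f z \<subseteq> W"
      using usc[OF x UW(2,4)] by blast
    have "V \<times> U \<subseteq> topspace X \<times> topspace X - ?G"
      using UW(5) V(3) openin_subset[OF UW(1)] openin_subset[OF V(1)]
      unfolding disjnt_iff by blast
    then show "\<exists>V U. openin X V \<and> openin X U \<and> x \<in> V \<and> y \<in> U \<and>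
        V \<times> U \<subseteq> topspace X \<times> topspace X - ?G"
      using UW(1,3) V(1,2) by (intro exI conjI)
  qed
  moreover have "?G \<subseteq> topspace X \<times> topspace X"
    using closedin_subset[OF closed] by auto
  ultimately show ?thesis
    by (simp add: closedin_def)
qed

lemma closedin_graph_imp_multivalued_map:
  assumes "compact_space X"
    and graph: "closedin (prod_topology X X) {(x, y). x \<in> topspace X \<and> y \<in> f x}"
      (is "closedin _ ?G")
    and nonempty: "\<And>x. x \<in> topspace X \<Longrightarrow> f x \<noteq> {}"
  shows "multivalued_map X f"
proof -
  have sub: "f x \<subseteq> topspace X" if "x \<in> topspace X" for x
    using closedin_subset[OF graph] that by auto
  have closed: "closedin X (f x)" if x: "x \<in> topspace X" for x
  proof -
    \<comment> \<open>Each value is a vertical slice of the closed graph, that is, its preimage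
      under this embedding.\<close>
    have "continuous_map X (prod_topology X X) (\<lambda>y. (x, y))"
      using x by (intro continuous_map_pairedI) auto
    then have "closedin X {y \<in> topspace X. (x, y) \<in> ?G}"
      using graph by (rule closedin_continuous_map_preimage)
    moreover have "{y \<in> topspace X. (x, y) \<in> ?G} = f x"
      using sub[OF x] x by auto
    ultimately show ?thesis
      by simp
  qed
  have "upper_semicontinuous_map X f"
    unfolding upper_semicontinuous_map_def
  proof (intro ballI allI impI, elim conjE)
    fix x U
    assume x: "x \<in> topspace X" and U: "openin X U" and fx: "f x \<subseteq> U"
    \<comment> \<open>\<open>B\<close> collects the points whose value leaves \<open>U\<close>. It
      is the projection of a closed part of the graph along a compact factor, hence closed, and its
      complement is the neighbourhood sought.\<close>
    define B where "B = fst ` (?G \<inter> topspace X \<times> (topspace X - U))"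
    have "closedin (prod_topology X X) (?G \<inter> topspace X \<times> (topspace X - U))"
      using graph U by (intro closedin_Int) (auto simp: closedin_prod_Times_iff)
    then have "closedin X B"
      unfolding B_def using closed_map_fst[OF assms(1)] by (auto simp: closed_map_def)
    then have "openin X (topspace X - B)"
      by blast
    moreover have "x \<in> topspace X - B"
      using x fx by (auto simp: B_def)
    moreover have "f y \<subseteq> U" if y: "y \<in> topspace X - B" for y
    proof
      fix z
      assume "z \<in> f y"
      then show "z \<in> U"
        using y sub[of y] by (force simp: B_def image_iff)
    qed
    ultimately show "\<exists>V. openin X V \<and> x \<in> V \<and> (\<forall>y\<in>V. f y \<subseteq> U)"
      by blast
  qed
  then show ?thesis
    using closed nonempty by (auto simp: multivalued_map_def closed_hyperspace_def)
qed

section \<open>Inverse limits of compact Hausdorff spaces\<close>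

lemma directed_set_finite_upper_bound:
  assumes "directed_set \<Lambda> r" and "finite F" and "F \<subseteq> \<Lambda>"
  shows "\<exists>n\<in>\<Lambda>. \<forall>l\<in>F. (l, n) \<in> r"
  using assms(2,3)
proof (induction F)
  case empty
  then show ?case
    using assms(1) by (auto simp: directed_set_def)
next
  case (insert k F)
  then obtain n where n: "n \<in> \<Lambda>" "\<forall>l\<in>F. (l, n) \<in> r"
    by auto
  obtain p where p: "p \<in> \<Lambda>" "(k, p) \<in> r" "(n, p) \<in> r"
    using assms(1) n(1) insert.prems unfolding directed_set_def by blast
  have "trans r"
    using assms(1) by (simp add: directed_set_def preorder_on_def)
  with n p have "\<forall>l\<in>insert k F. (l, p) \<in> r"
    by (auto dest: transD)
  with p(1) show ?case
    by blast
qed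

text \<open>Two continuous maps into a Hausdorff space agree on a closed set. These sets, one for
  each bonding equation, serve both to show that the limit is closed and to find a point in
  it.\<close>

lemma closedin_bonding_equalizer:
  assumes "l \<in> \<Lambda>" and "m \<in> \<Lambda>" and "Hausdorff_space (X l)"
    and "continuous_map (X m) (X l) (g l m)"
  shows "closedin (product_topology X \<Lambda>)
    {x \<in> topspace (product_topology X \<Lambda>). x l = g l m (x m)}"
proof (rule closedin_continuous_maps_eq[OF assms(3)])
  show "continuous_map (product_topology X \<Lambda>) (X l) (\<lambda>x. x l)"
    using assms(1) by (rule continuous_map_product_projection)
  show "continuous_map (product_topology X \<Lambda>) (X l) (\<lambda>x. g l m (x m))"
    using continuous_map_compose[OF continuous_map_product_projection[of m \<Lambda> X] assms(4)] assms(2)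
    by (simp add: o_def)
qed

text \<open>The factor \<open>topspace\<close> keeps the formula correct for empty \<open>r\<close>,
  where the indexed intersection is \<open>UNIV\<close>.\<close>

lemma inverse_limit_set_eq_Inter:
  "inverse_limit_set \<Lambda> r X g =
    topspace (product_topology X \<Lambda>) \<inter>
    (\<Inter>(l, m)\<in>r. {x \<in> topspace (product_topology X \<Lambda>). x l = g l m (x m)})"
  by (auto simp: inverse_limit_set_def)

lemma closedin_inverse_limit_set:
  assumes "r \<subseteq> \<Lambda> \<times> \<Lambda>" and "\<And>l. l \<in> \<Lambda> \<Longrightarrow> Hausdorff_space (X l)"
    and "\<And>l m. (l, m) \<in> r \<Longrightarrow> continuous_map (X m) (X l) (g l m)"
  shows "closedin (product_topology X \<Lambda>) (inverse_limit_set \<Lambda> r X g)"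
\<comment> \<open>\<open>closedin_INT\<close> requires a non-empty index set.\<close>
proof (cases "r = {}")
  case True
  then show ?thesis
    by (simp add: inverse_limit_set_eq_Inter del: topspace_product_topology)
next
  case False
  then show ?thesis
    unfolding inverse_limit_set_eq_Inter using assms
    by (intro closedin_Int closedin_topspace closedin_INT)
      (auto intro!: closedin_bonding_equalizer simp del: topspace_product_topology)
qed

text \<open>The product is compact by Tychonoff, so by the finite intersection property it suffices
  to solve finitely many bonding equations at a time.\<close>

lemma inverse_limit_set_nonempty:
  assumes directed: "directed_set \<Lambda> r"
    and compact: "\<And>l. l \<in> \<Lambda> \<Longrightarrow> compact_space (X l)"
    and Hausdorff: "\<And>l. l \<in> \<Lambda> \<Longrightarrow> Hausdorff_space (X l)"
    and nonempty: "\<And>l. l \<in> \<Lambda> \<Longrightarrow> topspace (X l) \<noteq> {}"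
    and cont: "\<And>l m. (l, m) \<in> r \<Longrightarrow> continuous_map (X m) (X l) (g l m)"
    and comp: "\<And>l m n x. (l, m) \<in> r \<Longrightarrow> (m, n) \<in> r \<Longrightarrow> x \<in> topspace (X n) \<Longrightarrow>
      g l n x = g l m (g m n x)"
  shows "inverse_limit_set \<Lambda> r X g \<noteq> {}"
proof -
  let ?P = "product_topology X \<Lambda>"
  define E where "E = (\<lambda>(l, m). {x \<in> topspace ?P. x l = g l m (x m)})"
  have r: "r \<subseteq> \<Lambda> \<times> \<Lambda>" and trans: "trans r"
    using directed by (simp_all add: directed_set_def preorder_on_def)
  have "compactin ?P (topspace ?P)"
    unfolding compact_space_def[symmetric] compact_space_product_topology using compact by blast
  moreover have "closedin ?P C" if "C \<in> E ` r" for C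
    using that r Hausdorff cont
    by (auto simp: E_def simp del: topspace_product_topology intro!: closedin_bonding_equalizer)
  moreover have "topspace ?P \<inter> \<Inter>\<F> \<noteq> {}" if fin: "finite \<F>" "\<F> \<subseteq> E ` r" for \<F>
  proof -
    obtain F where F: "finite F" "F \<subseteq> r" "\<F> = E ` F"
      using finite_subset_image[OF fin] by blast
    have "finite (Field F)"
      using F(1) by (rule finite_Field)
    moreover have "Field F \<subseteq> \<Lambda>"
      using F(2) r by (auto simp: Field_def)
    \<comment> \<open>\<open>n\<close> lies above every index occurring in the finitely many
      equations of \<open>F\<close>.\<close>
    ultimately obtain n where n: "n \<in> \<Lambda>" "\<forall>l\<in>Field F. (l, n) \<in> r"
      using directed_set_finite_upper_bound[OF directed] by blast
    obtain z where z: "z \<in> topspace (X n)"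
      using nonempty n(1) by blast
    \<comment> \<open>One point \<open>z\<close> of \<open>X n\<close> is pushed down to all indices
      below \<open>n\<close>, and functoriality of \<open>g\<close> then yields the equations of
      \<open>F\<close>. These do not involve the remaining coordinates, which are arbitrary.\<close>
    define y where "y = (\<lambda>l\<in>\<Lambda>. if (l, n) \<in> r then g l n z else SOME a. a \<in> topspace (X l))"
    have "g l n z \<in> topspace (X l)" if "(l, n) \<in> r" for l
      using continuous_map_funspace[OF cont[OF that]] z by blast
    then have "y \<in> topspace ?P"
      using nonempty by (auto simp: y_def some_in_eq)
    moreover have "y \<in> E (l, m)" if "(l, m) \<in> F" for l m
    proof -
      have "(l, m) \<in> r" "(l, n) \<in> r" "(m, n) \<in> r"
        using that F(2) n(2) by (auto simp: Field_def)
      then show ?thesis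
        using r comp z \<open>y \<in> topspace ?P\<close> by (auto simp: E_def y_def)
    qed
    ultimately have "y \<in> topspace ?P \<inter> \<Inter>\<F>"
      unfolding F(3) by auto
    then show ?thesis
      by blast
  qed
  ultimately have "topspace ?P \<inter> \<Inter>(E ` r) \<noteq> {}"
    by (simp add: compactin_fip del: topspace_product_topology)
  then show ?thesis
    by (simp add: inverse_limit_set_eq_Inter E_def case_prod_beta del: topspace_product_topology)
qed

section \<open>The limit space and the limit map\<close>

context inverse_system_of_multivalued_systems
begin

lemma index_relation: "r \<subseteq> \<Lambda> \<times> \<Lambda>"
  using directed by (simp add: directed_set_def preorder_on_def)

lemma space: "l \<in> \<Lambda> \<Longrightarrow> compact_space (X l)" "l \<in> \<Lambda> \<Longrightarrow> Hausdorff_space (X l)"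
  and multivalued: "l \<in> \<Lambda> \<Longrightarrow> multivalued_map (X l) (f l)"
  using system by (auto simp: multivalued_system_def)

lemma closedin_limit: "closedin (product_topology X \<Lambda>) (inverse_limit_set \<Lambda> r X g)"
  using index_relation space(2) continuous by (rule closedin_inverse_limit_set)

lemma topspace_inverse_limit: "topspace (inverse_limit \<Lambda> r X g) = inverse_limit_set \<Lambda> r X g"
  by (auto simp: inverse_limit_def inverse_limit_set_def)

text \<open>The limit is closed in a product that is compact by Tychonoff.\<close>

lemma compact_space_inverse_limit: "compact_space (inverse_limit \<Lambda> r X g)"
  unfolding inverse_limit_def using space(1) closedin_limit
  by (intro compact_space_subtopology closedin_compact_space)
    (auto simp: compact_space_product_topology)

lemma Hausdorff_space_inverse_limit: "Hausdorff_space (inverse_limit \<Lambda> r X g)"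
  unfolding inverse_limit_def using space(2)
  by (intro Hausdorff_space_subtopology) (auto simp: Hausdorff_space_product_topology)

lemma continuous_map_inverse_limit_projection:
  "l \<in> \<Lambda> \<Longrightarrow> continuous_map (inverse_limit \<Lambda> r X g) (X l) (\<lambda>x. x l)"
  unfolding inverse_limit_def
  by (intro continuous_map_from_subtopology continuous_map_product_projection)

lemma inverse_limit_map_nonempty:
  assumes x: "x \<in> inverse_limit_set \<Lambda> r X g"
  shows "inverse_limit_map \<Lambda> r X g f x \<noteq> {}"
proof -
  \<comment> \<open>A thread through the subspaces \<open>Y l\<close> is exactly an element of the
    limit map's value at \<open>x\<close>.\<close>
  define Y where "Y l = subtopology (X l) (f l (x l))" for l
  have xl: "x l \<in> topspace (X l)" if "l \<in> \<Lambda>" for l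
    using x that by (auto simp: inverse_limit_set_def)
  have f: "closedin (X l) (f l (x l))" "f l (x l) \<noteq> {}" if "l \<in> \<Lambda>" for l
    using multivalued[OF that] xl[OF that] by (auto simp: multivalued_map_def closed_hyperspace_def)
  have topY: "topspace (Y l) = f l (x l)" if "l \<in> \<Lambda>" for l
    using closedin_subset[OF f(1)[OF that]] by (auto simp: Y_def)
  have "inverse_limit_set \<Lambda> r Y g \<noteq> {}"
  proof (rule inverse_limit_set_nonempty[OF directed])
    show "compact_space (Y l)" if "l \<in> \<Lambda>" for l
      unfolding Y_def using space(1) f(1) that
      by (intro compact_space_subtopology closedin_compact_space)
    show "Hausdorff_space (Y l)" if "l \<in> \<Lambda>" for l
      unfolding Y_def using space(2) that by (intro Hausdorff_space_subtopology)
    show "topspace (Y l) \<noteq> {}" if "l \<in> \<Lambda>" for l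
      using that by (simp add: topY f(2))
    show "continuous_map (Y m) (Y l) (g l m)" if lm: "(l, m) \<in> r" for l m
    proof -
      have m: "m \<in> \<Lambda>"
        using lm index_relation by blast
      have "x l = g l m (x m)"
        using x lm by (auto simp: inverse_limit_set_def)
      \<comment> \<open>Compatibility of the coordinates of \<open>x\<close> is what lets the
        bonding maps restrict to the chosen values.\<close>
      then have "g l m ` f m (x m) \<subseteq> f l (x l)"
        using bonding_subset[OF lm xl[OF m]] by simp
      then show ?thesis
        unfolding Y_def using continuous[OF lm]
        by (auto simp: continuous_map_in_subtopology continuous_map_from_subtopology)
    qed
    show "g l n z = g l m (g m n z)"
      if "(l, m) \<in> r" "(m, n) \<in> r" "z \<in> topspace (Y n)" for l m n z
      using that bonding_comp by (auto simp: Y_def)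
  qed
  then obtain y where y: "y \<in> inverse_limit_set \<Lambda> r Y g"
    by blast
  have "y l \<in> f l (x l)" if "l \<in> \<Lambda>" for l
    using y that topY by (auto simp: inverse_limit_set_def)
  moreover have "y \<in> inverse_limit_set \<Lambda> r X g"
    using y by (auto simp: inverse_limit_set_def Y_def PiE_iff)
  ultimately show ?thesis
    by (auto simp: inverse_limit_map_def)
qed

lemma closedin_graph_inverse_limit_map:
  fixes L
  defines "L \<equiv> inverse_limit \<Lambda> r X g"
  shows "closedin (prod_topology L L)
    {(x, y). x \<in> topspace L \<and> y \<in> inverse_limit_map \<Lambda> r X g f x}" (is "closedin _ ?G")
proof -
  \<comment> \<open>\<open>H l\<close> is the preimage of the graph of \<open>f l\<close> under the
    \<open>l\<close>-th projection in both arguments.\<close>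
  define H where "H l = {p \<in> topspace (prod_topology L L).
    (fst p l, snd p l) \<in> {(a, b). a \<in> topspace (X l) \<and> b \<in> f l a}}" for l
  have "closedin (prod_topology L L) (H l)" if l: "l \<in> \<Lambda>" for l
  proof -
    have "continuous_map (prod_topology L L) (prod_topology (X l) (X l))
        (\<lambda>p. (fst p l, snd p l))"
      using continuous_map_compose[OF continuous_map_fst continuous_map_inverse_limit_projection[OF l]]
        continuous_map_compose[OF continuous_map_snd continuous_map_inverse_limit_projection[OF l]]
      unfolding L_def by (intro continuous_map_pairedI) (simp_all add: o_def)
    moreover have "closedin (prod_topology (X l) (X l)) {(a, b). a \<in> topspace (X l) \<and> b \<in> f l a}"
      using space multivalued l
      by (intro multivalued_map_imp_closedin_graph compact_Hausdorff_imp_regular_space)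
    ultimately show ?thesis
      unfolding H_def by (rule closedin_continuous_map_preimage)
  qed
  \<comment> \<open>A non-empty index set makes the intersection of the \<open>H l\<close> closed
    and confines it to pairs of points of \<open>L\<close>.\<close>
  moreover have "\<Lambda> \<noteq> {}"
    using directed by (simp add: directed_set_def)
  ultimately have "closedin (prod_topology L L) (\<Inter>l\<in>\<Lambda>. H l)"
    by (intro closedin_INT)
  moreover have "(\<Inter>l\<in>\<Lambda>. H l) = ?G"
    using \<open>\<Lambda> \<noteq> {}\<close>
    by (auto simp: H_def L_def topspace_inverse_limit inverse_limit_map_def)
      (auto simp: inverse_limit_set_def)
  ultimately show ?thesis
    by simp
qed

end

theorem theorem2p12:
  fixes \<Lambda> :: "'i set"
    and r :: "'i rel"
    and X :: "'i \<Rightarrow> 'a topology"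
    and f :: "'i \<Rightarrow> 'a \<Rightarrow> 'a set"
    and g :: "'i \<Rightarrow> 'i \<Rightarrow> 'a \<Rightarrow> 'a"
  assumes "inverse_system_of_multivalued_systems \<Lambda> r X f g"
  shows "multivalued_system (inverse_limit \<Lambda> r X g) (inverse_limit_map \<Lambda> r X g f)"
proof -
  interpret inverse_system_of_multivalued_systems \<Lambda> r X f g
    by (fact assms)
  \<comment> \<open>Since the limit space is compact, the closed graph and the non-empty values give
    both closed values and upper semicontinuity.\<close>
  have "multivalued_map (inverse_limit \<Lambda> r X g) (inverse_limit_map \<Lambda> r X g f)"
    using compact_space_inverse_limit closedin_graph_inverse_limit_map
    by (rule closedin_graph_imp_multivalued_map)
      (simp add: topspace_inverse_limit inverse_limit_map_nonempty)
  then show ?thesis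
    using compact_space_inverse_limit Hausdorff_space_inverse_limit
    by (simp add: multivalued_system_def)
qed

end
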